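(* Let $(M^n,g)$ be an $n$-dimensional Riemannian manifold, $f\in C^\infty(M)$ and $\lambda\in\mathbb{R}$ such that $(g,f,\lambda)$ is a gradient Ricci soliton on $M$, i.e. $$H_f+Ric+\lambda g=0 .$$ Then the following double inequality holds on $M$: $$\|H_f\|^2_g-\frac{1}{n}(\Delta f)^2\;\leq\; \|Ric\|^2_g\;\leq\; \|H_f\|^2_g+\frac{R^2}{n}.$$ Moreover, both inequalities are simultaneously equalities if and only if $H_f=\pm Ric$ with $\Delta f=R=0$; hence in this case $f$ is harmonic.
   Context: $\nabla$ is the Levi-Civita connection of $g$. $H_f(X,Y)=g(\nabla_X\nabla f,Y)$ is the Hessian tensor field of $f$ (where $\nabla f$ is the gradient of $f$), $\Delta f=Tr_g H_f$ is the Laplacian of $f$, $Ric$ is the Ricci tensor field of $g$, and $R=Tr_g Ric$ is the scalar curvature of $g$. For a symmetric $(0,2)$-tensor field $T$, $\|T\|_g^2=\sum_{i,j}T(E_i,E_j)^2$ for any local $g$-orthonormal frame $\{E_i\}$. *)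

theory Defs
  imports "HOL-Analysis.Analysis"
begin

section \<open>Smooth maps between normed spaces\<close>

text \<open>Only used on open sets \<open>S\<close> of a finite-dimensional domain, where control of all
  directional derivatives amounts to being of class \<open>C\<^sup>k\<close>.\<close>

primrec Ck_on :: "nat \<Rightarrow> ('a::real_normed_vector \<Rightarrow> 'b::real_normed_vector) \<Rightarrow> 'a set \<Rightarrow> bool" where
  "Ck_on 0 f S \<longleftrightarrow> continuous_on S f"
| "Ck_on (Suc k) f S \<longleftrightarrow>
     (\<forall>x\<in>S. f differentiable (at x)) \<and> (\<forall>v. Ck_on k (\<lambda>x. frechet_derivative f (at x) v) S)"

definition smooth_on :: "'a::real_normed_vector set \<Rightarrow> ('a \<Rightarrow> 'b::real_normed_vector) \<Rightarrow> bool" where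
  "smooth_on S f \<longleftrightarrow> (\<forall>k. Ck_on k f S)"


section \<open>Smooth manifolds\<close>

text \<open>A chart is a pair \<open>(U, \<phi>)\<close> of an open set and a homeomorphism of \<open>U\<close> onto an open subset of
  \<open>\<real>\<^sup>n\<close>; only the values of \<open>\<phi>\<close> on \<open>U\<close> matter. The atlas need not be maximal. The dimension is
  \<open>CARD('n)\<close>.\<close>

record ('a, 'n::finite) manifold =
  mtop :: "'a topology"
  atlas :: "('a set \<times> ('a \<Rightarrow> real ^ 'n)) set"

abbreviation points :: "('a, 'n::finite) manifold \<Rightarrow> 'a set" where
  "points M \<equiv> topspace (mtop M)"

definition smooth_manifold :: "('a, 'n::finite) manifold \<Rightarrow> bool" where
  "smooth_manifold M \<longleftrightarrow>
     Hausdorff_space (mtop M) \<and> second_countable (mtop M) \<and>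
     (\<forall>(U, \<phi>) \<in> atlas M. openin (mtop M) U \<and> open (\<phi> ` U) \<and>
        homeomorphic_map (subtopology (mtop M) U) (top_of_set (\<phi> ` U)) \<phi>) \<and>
     \<Union> (fst ` atlas M) = points M \<and>
     (\<forall>(U, \<phi>) \<in> atlas M. \<forall>(V, \<psi>) \<in> atlas M. smooth_on (\<phi> ` (U \<inter> V)) (\<psi> \<circ> inv_into U \<phi>))"

text \<open>Functions are total on \<open>'a\<close>; \<open>f\<close> is a smooth real function on the open set \<open>W\<close>.\<close>

definition smooth_fun :: "('a, 'n::finite) manifold \<Rightarrow> 'a set \<Rightarrow> ('a \<Rightarrow> real) \<Rightarrow> bool" where
  "smooth_fun M W f \<longleftrightarrow> openin (mtop M) W \<and>
     (\<forall>(U, \<phi>) \<in> atlas M. smooth_on (\<phi> ` (U \<inter> W)) (f \<circ> inv_into U \<phi>))"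

definition smooth_near :: "('a, 'n::finite) manifold \<Rightarrow> 'a \<Rightarrow> ('a \<Rightarrow> real) \<Rightarrow> bool" where
  "smooth_near M p f \<longleftrightarrow> (\<exists>W. p \<in> W \<and> smooth_fun M W f)"

definition smooth_curve :: "('a, 'n::finite) manifold \<Rightarrow> real set \<Rightarrow> (real \<Rightarrow> 'a) \<Rightarrow> bool" where
  "smooth_curve M I \<gamma> \<longleftrightarrow> open I \<and> continuous_map (top_of_set I) (mtop M) \<gamma> \<and>
     (\<forall>(U, \<phi>) \<in> atlas M. smooth_on {t \<in> I. \<gamma> t \<in> U} (\<phi> \<circ> \<gamma>))"


section \<open>Tangent vectors and vector fields\<close>

text \<open>A tangent vector at \<open>p\<close> is the velocity at time \<open>0\<close> of a smooth curve through \<open>p\<close>, identified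
  with the functional \<open>f \<mapsto> (f \<circ> \<gamma>)'(0)\<close> on functions that are smooth near \<open>p\<close>. It is extended by
  \<open>0\<close> to all other functions, so that equality of tangent vectors is equality of functionals.\<close>

type_synonym 'a tvec = "('a \<Rightarrow> real) \<Rightarrow> real"
type_synonym 'a vfield = "'a \<Rightarrow> 'a tvec"

definition velocity :: "('a, 'n::finite) manifold \<Rightarrow> (real \<Rightarrow> 'a) \<Rightarrow> 'a tvec" where
  "velocity M \<gamma> = (\<lambda>f. if smooth_near M (\<gamma> 0) f then deriv (f \<circ> \<gamma>) 0 else 0)"

definition tangent_space :: "('a, 'n::finite) manifold \<Rightarrow> 'a \<Rightarrow> 'a tvec set" where
  "tangent_space M p =
     {velocity M \<gamma> | \<gamma> \<epsilon>. \<epsilon> > 0 \<and> smooth_curve M {-\<epsilon><..<\<epsilon>} \<gamma> \<and> \<gamma> 0 = p}"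

definition lincomb :: "real \<Rightarrow> 'a tvec \<Rightarrow> real \<Rightarrow> 'a tvec \<Rightarrow> 'a tvec" where
  "lincomb a v b w = (\<lambda>f. a * v f + b * w f)"

definition vector_field :: "('a, 'n::finite) manifold \<Rightarrow> 'a set \<Rightarrow> 'a vfield \<Rightarrow> bool" where
  "vector_field M W X \<longleftrightarrow> openin (mtop M) W \<and> (\<forall>p\<in>W. X p \<in> tangent_space M p) \<and>
     (\<forall>V f. V \<subseteq> W \<and> smooth_fun M V f \<longrightarrow> smooth_fun M V (\<lambda>p. X p f))"

definition vector_field_near :: "('a, 'n::finite) manifold \<Rightarrow> 'a \<Rightarrow> 'a vfield \<Rightarrow> bool" where
  "vector_field_near M p X \<longleftrightarrow> (\<exists>W. p \<in> W \<and> vector_field M W X)"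

definition lie_bracket ::
  "('a, 'n::finite) manifold \<Rightarrow> 'a vfield \<Rightarrow> 'a vfield \<Rightarrow> 'a vfield" where
  "lie_bracket M X Y p =
     (\<lambda>f. if smooth_near M p f then X p (\<lambda>q. Y q f) - Y p (\<lambda>q. X q f) else 0)"


section \<open>Riemannian metrics and the Levi-Civita connection\<close>

type_synonym 'a tensor02 = "'a \<Rightarrow> 'a tvec \<Rightarrow> 'a tvec \<Rightarrow> real"

definition riemannian_metric :: "('a, 'n::finite) manifold \<Rightarrow> 'a tensor02 \<Rightarrow> bool" where
  "riemannian_metric M g \<longleftrightarrow>
     (\<forall>p\<in>points M. \<forall>u\<in>tangent_space M p. \<forall>v\<in>tangent_space M p.
        g p u v = g p v u \<and>
        (\<forall>w\<in>tangent_space M p. \<forall>a b. g p (lincomb a u b v) w = a * g p u w + b * g p v w) \<and>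
        (u \<noteq> (\<lambda>_. 0) \<longrightarrow> g p u u > 0)) \<and>
     (\<forall>W X Y. vector_field M W X \<and> vector_field M W Y \<longrightarrow> smooth_fun M W (\<lambda>p. g p (X p) (Y p)))"

text \<open>\<open>D p v Y\<close> is the covariant derivative at \<open>p\<close> in the direction \<open>v \<in> T\<^sub>pM\<close> of a vector field
  \<open>Y\<close> that is smooth near \<open>p\<close>; for vector fields, \<open>cov_deriv D X Y\<close> is \<open>\<nabla>\<^sub>X Y\<close>. Tensoriality in the
  first argument is thus built in, and dependence on the germ of \<open>Y\<close> only follows from the Leibniz
  rule applied to indicator functions of neighbourhoods of \<open>p\<close>.\<close>

type_synonym 'a connection = "'a \<Rightarrow> 'a tvec \<Rightarrow> 'a vfield \<Rightarrow> 'a tvec"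

definition cov_deriv :: "'a connection \<Rightarrow> 'a vfield \<Rightarrow> 'a vfield \<Rightarrow> 'a vfield" where
  "cov_deriv D X Y = (\<lambda>p. D p (X p) Y)"

definition affine_connection :: "('a, 'n::finite) manifold \<Rightarrow> 'a connection \<Rightarrow> bool" where
  "affine_connection M D \<longleftrightarrow>
     (\<forall>p\<in>points M. \<forall>v\<in>tangent_space M p. \<forall>Y. vector_field_near M p Y \<longrightarrow>
        D p v Y \<in> tangent_space M p \<and>
        (\<forall>u\<in>tangent_space M p. \<forall>a b.
           D p (lincomb a u b v) Y = lincomb a (D p u Y) b (D p v Y)) \<and>
        (\<forall>Z. vector_field_near M p Z \<longrightarrow>
           D p v (\<lambda>q. lincomb 1 (Y q) 1 (Z q)) = lincomb 1 (D p v Y) 1 (D p v Z)) \<and>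
        (\<forall>h. smooth_near M p h \<longrightarrow>
           D p v (\<lambda>q k. h q * Y q k) = lincomb (v h) (Y p) (h p) (D p v Y))) \<and>
     (\<forall>W X Y. vector_field M W X \<and> vector_field M W Y \<longrightarrow> vector_field M W (cov_deriv D X Y))"

definition torsion_free :: "('a, 'n::finite) manifold \<Rightarrow> 'a connection \<Rightarrow> bool" where
  "torsion_free M D \<longleftrightarrow>
     (\<forall>W X Y. vector_field M W X \<and> vector_field M W Y \<longrightarrow>
        (\<forall>p\<in>W. lincomb 1 (cov_deriv D X Y p) (-1) (cov_deriv D Y X p) = lie_bracket M X Y p))"

definition metric_compatible ::
  "('a, 'n::finite) manifold \<Rightarrow> 'a tensor02 \<Rightarrow> 'a connection \<Rightarrow> bool" where
  "metric_compatible M g D \<longleftrightarrow>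
     (\<forall>p\<in>points M. \<forall>v\<in>tangent_space M p. \<forall>Y Z.
        vector_field_near M p Y \<and> vector_field_near M p Z \<longrightarrow>
        v (\<lambda>q. g q (Y q) (Z q)) = g p (D p v Y) (Z p) + g p (Y p) (D p v Z))"

definition levi_civita :: "('a, 'n::finite) manifold \<Rightarrow> 'a tensor02 \<Rightarrow> 'a connection \<Rightarrow> bool" where
  "levi_civita M g D \<longleftrightarrow>
     affine_connection M D \<and> torsion_free M D \<and> metric_compatible M g D"


section \<open>Traces and norms\<close>

text \<open>Since \<open>CARD('n)\<close> is the dimension of \<open>T\<^sub>pM\<close>, such a family is a basis. The trace and the
  norm of a \<open>(0,2)\<close>-tensor do not depend on which orthonormal basis is used, and the values at \<open>p\<close>
  of local orthonormal frames are exactly the orthonormal bases of \<open>T\<^sub>pM\<close>.\<close>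

definition orthonormal_basis ::
  "('a, 'n::finite) manifold \<Rightarrow> 'a tensor02 \<Rightarrow> 'a \<Rightarrow> ('n \<Rightarrow> 'a tvec) \<Rightarrow> bool" where
  "orthonormal_basis M g p E \<longleftrightarrow>
     (\<forall>i. E i \<in> tangent_space M p) \<and> (\<forall>i j. g p (E i) (E j) = (if i = j then 1 else 0))"

definition frame :: "('a, 'n::finite) manifold \<Rightarrow> 'a tensor02 \<Rightarrow> 'a \<Rightarrow> 'n \<Rightarrow> 'a tvec" where
  "frame M g p = (SOME E. orthonormal_basis M g p E)"

definition metric_trace :: "('a, 'n::finite) manifold \<Rightarrow> 'a tensor02 \<Rightarrow> 'a tensor02 \<Rightarrow> 'a \<Rightarrow> real" where
  "metric_trace M g T p = (\<Sum>i\<in>UNIV. T p (frame M g p i) (frame M g p i))"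

definition norm_sq :: "('a, 'n::finite) manifold \<Rightarrow> 'a tensor02 \<Rightarrow> 'a tensor02 \<Rightarrow> 'a \<Rightarrow> real" where
  "norm_sq M g T p = (\<Sum>i\<in>UNIV. \<Sum>j\<in>UNIV. (T p (frame M g p i) (frame M g p j))\<^sup>2)"


section \<open>Gradient, Hessian, Laplacian\<close>

definition grad :: "('a, 'n::finite) manifold \<Rightarrow> 'a tensor02 \<Rightarrow> ('a \<Rightarrow> real) \<Rightarrow> 'a vfield" where
  "grad M g f p =
     (THE v. v \<in> tangent_space M p \<and> (\<forall>w\<in>tangent_space M p. g p v w = w f))"

definition hessian ::
  "('a, 'n::finite) manifold \<Rightarrow> 'a tensor02 \<Rightarrow> 'a connection \<Rightarrow> ('a \<Rightarrow> real) \<Rightarrow> 'a tensor02" where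
  "hessian M g D f p v w = g p (D p v (grad M g f)) w"

definition laplacian ::
  "('a, 'n::finite) manifold \<Rightarrow> 'a tensor02 \<Rightarrow> 'a connection \<Rightarrow> ('a \<Rightarrow> real) \<Rightarrow> 'a \<Rightarrow> real" where
  "laplacian M g D f = metric_trace M g (hessian M g D f)"

definition harmonic ::
  "('a, 'n::finite) manifold \<Rightarrow> 'a tensor02 \<Rightarrow> 'a connection \<Rightarrow> ('a \<Rightarrow> real) \<Rightarrow> bool" where
  "harmonic M g D f \<longleftrightarrow> (\<forall>p\<in>points M. laplacian M g D f p = 0)"


section \<open>Curvature\<close>

text \<open>\<open>R(X,Y)Z = \<nabla>\<^sub>X \<nabla>\<^sub>Y Z - \<nabla>\<^sub>Y \<nabla>\<^sub>X Z - \<nabla>\<^bsub>[X,Y]\<^esub> Z\<close>\<close>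

definition curvature ::
  "('a, 'n::finite) manifold \<Rightarrow> 'a connection \<Rightarrow> 'a vfield \<Rightarrow> 'a vfield \<Rightarrow> 'a vfield \<Rightarrow> 'a vfield" where
  "curvature M D X Y Z p = (\<lambda>f.
     cov_deriv D X (cov_deriv D Y Z) p f - cov_deriv D Y (cov_deriv D X Z) p f
     - cov_deriv D (lie_bracket M X Y) Z p f)"

text \<open>By tensoriality, \<open>R(X,Y)Z\<close> at \<open>p\<close> depends only on the values of the fields at \<open>p\<close>; the
  curvature endomorphism of \<open>T\<^sub>pM\<close> is the common value over all local extensions.\<close>

definition curvature_at ::
  "('a, 'n::finite) manifold \<Rightarrow> 'a connection \<Rightarrow> 'a \<Rightarrow> 'a tvec \<Rightarrow> 'a tvec \<Rightarrow> 'a tvec \<Rightarrow> 'a tvec" where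
  "curvature_at M D p u v w = (THE r. \<forall>X Y Z.
     vector_field_near M p X \<and> vector_field_near M p Y \<and> vector_field_near M p Z \<and>
     X p = u \<and> Y p = v \<and> Z p = w \<longrightarrow> curvature M D X Y Z p = r)"

text \<open>\<open>Ric(v,w)\<close> is the trace of \<open>u \<mapsto> R(u,v)w\<close>, positive on round spheres.\<close>

definition ricci ::
  "('a, 'n::finite) manifold \<Rightarrow> 'a tensor02 \<Rightarrow> 'a connection \<Rightarrow> 'a tensor02" where
  "ricci M g D p v w = metric_trace M g (\<lambda>q u u'. g q (curvature_at M D q u v w) u') p"

definition scalar_curvature ::
  "('a, 'n::finite) manifold \<Rightarrow> 'a tensor02 \<Rightarrow> 'a connection \<Rightarrow> 'a \<Rightarrow> real" where
  "scalar_curvature M g D = metric_trace M g (ricci M g D)"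


section \<open>Gradient Ricci solitons\<close>

definition gradient_ricci_soliton ::
  "('a, 'n::finite) manifold \<Rightarrow> 'a tensor02 \<Rightarrow> 'a connection \<Rightarrow> ('a \<Rightarrow> real) \<Rightarrow> real \<Rightarrow> bool" where
  "gradient_ricci_soliton M g D f c \<longleftrightarrow>
     (\<forall>p\<in>points M. \<forall>v\<in>tangent_space M p. \<forall>w\<in>tangent_space M p.
        hessian M g D f p v w + ricci M g D p v w + c * g p v w = 0)"

definition tensor_eq_at :: "('a, 'n::finite) manifold \<Rightarrow> 'a \<Rightarrow> 'a tensor02 \<Rightarrow> 'a tensor02 \<Rightarrow> bool" where
  "tensor_eq_at M p S T \<longleftrightarrow>
     (\<forall>v\<in>tangent_space M p. \<forall>w\<in>tangent_space M p. S p v w = T p v w)"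

end

theory Submission
  imports Defs
begin

text \<open>
  In an orthonormal basis of \<open>T\<^sub>pM\<close> the soliton equation says that the matrices of the Hessian and
  the Ricci tensor satisfy \<open>Ric = - H - c I\<close>, where \<open>c\<close> is the soliton constant. Taking traces gives
  \<open>R = - \<Delta>f - n c\<close>, and taking square norms gives
  \<open>\<parallel>Ric\<parallel>\<^sup>2 = \<parallel>H\<parallel>\<^sup>2 + 2 c \<Delta>f + n c\<^sup>2\<close>. Eliminating \<open>c\<close> leaves the identity
  (\<open>norm_sq_identity\<close>)
    \<open>\<parallel>Ric\<parallel>\<^sup>2 - \<parallel>H\<parallel>\<^sup>2 = (R\<^sup>2 - (\<Delta>f)\<^sup>2) / n\<close>,
  from which both inequalities are immediate: one drops \<open>R\<^sup>2\<close>, the other drops \<open>(\<Delta>f)\<^sup>2\<close>. Both are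
  equalities exactly when \<open>R = \<Delta>f = 0\<close>; the trace relation then forces \<open>c = 0\<close>, and the soliton
  equation becomes \<open>H = - Ric\<close>.

  The argument is pointwise linear algebra; the geometric input is that the chosen
  \<open>frame M g p\<close> really is an orthonormal basis, that is, that \<open>T\<^sub>pM\<close> contains \<open>n\<close> orthonormal
  vectors (\<open>orthonormal_basis_exists\<close>). Straight lines in a chart around \<open>p\<close> give a linear map
  \<open>\<real>\<^sup>n \<rightarrow> T\<^sub>pM\<close> (\<open>chart_vector_tangent\<close>, \<open>chart_vector_lincomb\<close>), which is injective because the
  coordinate functions detect the components (\<open>chart_vector_coordinate\<close>). The metric therefore
  pulls back to an inner product on \<open>\<real>\<^sup>n\<close>, to which Gram-Schmidt applies.
\<close>

section \<open>Calculus of the classes \<open>C\<^sup>k\<close>\<close>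

text \<open>Derivatives only see germs, so values off the open set \<open>S\<close> do not matter. This is what allows
  a formula for the derivative, valid on \<open>S\<close> only, to be used in inductions on \<open>k\<close>.\<close>

lemma Ck_on_cong:
  assumes "open S" "\<And>x. x \<in> S \<Longrightarrow> f x = h x"
  shows "Ck_on k f S \<longleftrightarrow> Ck_on k h S"
  using assms(2)
proof (induction k arbitrary: f h)
  case 0
  then show ?case by (simp cong: continuous_on_cong)
next
  case (Suc k)
  have deriv_eq: "(f has_derivative d) (at x) \<longleftrightarrow> (h has_derivative d) (at x)" if "x \<in> S" for x d
    using Suc.prems assms(1) that by (metis has_derivative_transform_within_open)
  then have "frechet_derivative f (at x) = frechet_derivative h (at x)" if "x \<in> S" for x
    using that by (simp add: frechet_derivative_def)
  then have "Ck_on k (\<lambda>x. frechet_derivative f (at x) v) S \<longleftrightarrow>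
      Ck_on k (\<lambda>x. frechet_derivative h (at x) v) S" for v
    by (intro Suc.IH) simp
  then show ?case
    using deriv_eq by (simp add: differentiable_def)
qed

text \<open>The derivative of the restriction to a line in direction \<open>s\<close> is the restriction to that line
  of the derivative of \<open>h\<close> in the fixed direction \<open>s *\<^sub>R x\<close>, again a restriction of a
  \<open>C\<^sup>k\<close> function to a line.\<close>

lemma Ck_on_line:
  fixes h :: "'a::real_normed_vector \<Rightarrow> 'b::real_normed_vector"
  assumes "open T" "\<And>t. t \<in> T \<Longrightarrow> a + t *\<^sub>R x \<in> S" "Ck_on k h S"
  shows "Ck_on k (\<lambda>t::real. h (a + t *\<^sub>R x)) T"
  using assms(3)
proof (induction k arbitrary: h)
  case 0
  then show ?case
    using assms(2) by (auto intro!: continuous_on_compose2[of S h] continuous_intros)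
next
  case (Suc k)
  have D: "((\<lambda>t. h (a + t *\<^sub>R x)) has_derivative
      (\<lambda>s. frechet_derivative h (at (a + t *\<^sub>R x)) (s *\<^sub>R x))) (at t)" if "t \<in> T" for t
  proof -
    have "(h has_derivative frechet_derivative h (at (a + t *\<^sub>R x))) (at (a + t *\<^sub>R x))"
      using Suc.prems assms(2)[OF that] by (simp add: frechet_derivative_works)
    moreover have "((\<lambda>t. a + t *\<^sub>R x) has_derivative (\<lambda>s. s *\<^sub>R x)) (at t)"
      by (auto intro!: derivative_eq_intros)
    ultimately show ?thesis
      by (rule has_derivative_compose[rotated])
  qed
  have "Ck_on k (\<lambda>t. frechet_derivative (\<lambda>t. h (a + t *\<^sub>R x)) (at t) v) T" for v
  proof (subst Ck_on_cong[OF assms(1)])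
    show "frechet_derivative (\<lambda>t. h (a + t *\<^sub>R x)) (at t) v =
        frechet_derivative h (at (a + t *\<^sub>R x)) (v *\<^sub>R x)" if "t \<in> T" for t
      using frechet_derivative_at[OF D[OF that]] by metis
    show "Ck_on k (\<lambda>t. frechet_derivative h (at (a + t *\<^sub>R x)) (v *\<^sub>R x)) T"
      using Suc.IH[of "\<lambda>y. frechet_derivative h (at y) (v *\<^sub>R x)"] Suc.prems by simp
  qed
  then show ?case
    using D by (auto simp: differentiable_def)
qed

lemma Ck_on_bounded_linear:
  assumes "open S" "bounded_linear l" "Ck_on k h S"
  shows "Ck_on k (\<lambda>x. l (h x)) S"
  using assms(3)
proof (induction k arbitrary: h)
  case 0
  then show ?case
    using assms(2) by (auto intro: bounded_linear.continuous_on)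
next
  case (Suc k)
  have D: "((\<lambda>x. l (h x)) has_derivative (\<lambda>v. l (frechet_derivative h (at x) v))) (at x)"
    if "x \<in> S" for x
    using Suc.prems that by (auto simp: frechet_derivative_works
        intro!: bounded_linear.has_derivative[OF assms(2)])
  have "Ck_on k (\<lambda>x. frechet_derivative (\<lambda>x. l (h x)) (at x) v) S" for v
  proof (subst Ck_on_cong[OF assms(1)])
    show "frechet_derivative (\<lambda>x. l (h x)) (at x) v = l (frechet_derivative h (at x) v)"
      if "x \<in> S" for x
      using frechet_derivative_at[OF D[OF that]] by metis
    show "Ck_on k (\<lambda>x. l (frechet_derivative h (at x) v)) S"
      using Suc.IH[of "\<lambda>y. frechet_derivative h (at y) v"] Suc.prems by simp
  qed
  then show ?case
    using D by (auto simp: differentiable_def)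
qed


section \<open>Tangent vectors in a chart\<close>

lemma chart_facts:
  assumes "smooth_manifold M" "(U, \<phi>) \<in> atlas M"
  shows chart_openin: "openin (mtop M) U"
    and chart_open: "open (\<phi> ` U)"
    and chart_inj: "inj_on \<phi> U"
    and chart_inv_continuous: "continuous_map (top_of_set (\<phi> ` U)) (mtop M) (inv_into U \<phi>)"
    and chart_image_open: "openin (mtop M) W \<Longrightarrow> open (\<phi> ` (U \<inter> W))"
proof -
  show U: "openin (mtop M) U" and o: "open (\<phi> ` U)"
    using assms by (auto simp: smooth_manifold_def)
  have hom: "homeomorphic_map (subtopology (mtop M) U) (top_of_set (\<phi> ` U)) \<phi>"
    using assms by (auto simp: smooth_manifold_def)
  have ts: "topspace (subtopology (mtop M) U) = U"
    using openin_subset[OF U] by auto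
  show inj: "inj_on \<phi> U"
    using homeomorphic_imp_injective_map[OF hom] ts by simp
  obtain k where k: "homeomorphic_maps (subtopology (mtop M) U) (top_of_set (\<phi> ` U)) \<phi> k"
    using hom by (auto simp: homeomorphic_map_maps)
  then have "continuous_map (top_of_set (\<phi> ` U)) (mtop M) k"
    by (auto simp: homeomorphic_maps_def continuous_map_in_subtopology)
  moreover have "k y = inv_into U \<phi> y" if "y \<in> \<phi> ` U" for y
    using that k inj ts by (auto simp: homeomorphic_maps_def)
  ultimately show "continuous_map (top_of_set (\<phi> ` U)) (mtop M) (inv_into U \<phi>)"
    by (auto elim: continuous_map_eq)
  show "open (\<phi> ` (U \<inter> W))" if "openin (mtop M) W"
  proof -
    have "openin (subtopology (mtop M) U) (U \<inter> W)"
      using that by (auto simp: openin_subtopology)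
    then have "openin (top_of_set (\<phi> ` U)) (\<phi> ` (U \<inter> W))"
      using hom homeomorphic_imp_open_map open_map_def by blast
    then show ?thesis using o openin_open_trans by blast
  qed
qed

text \<open>The coordinate vector \<open>\<Sum>\<^sub>i x\<^sub>i \<partial>/\<partial>\<phi>\<^sub>i\<close> at \<open>p\<close>, with the default value \<open>0\<close> that makes tangent
  vectors comparable as total functionals.\<close>

definition chart_vector ::
  "('a, 'n::finite) manifold \<Rightarrow> 'a set \<Rightarrow> ('a \<Rightarrow> real ^ 'n) \<Rightarrow> 'a \<Rightarrow> real ^ 'n \<Rightarrow> 'a tvec" where
  "chart_vector M U \<phi> p x = (\<lambda>f. if smooth_near M p f
     then frechet_derivative (f \<circ> inv_into U \<phi>) (at (\<phi> p)) x else 0)"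

lemma smooth_near_differentiable:
  assumes "(U, \<phi>) \<in> atlas M" "p \<in> U" "smooth_near M p f"
  shows "(f \<circ> inv_into U \<phi>) differentiable (at (\<phi> p))"
proof -
  obtain W where "p \<in> W" "smooth_fun M W f"
    using assms(3) by (auto simp: smooth_near_def)
  then have "smooth_on (\<phi> ` (U \<inter> W)) (f \<circ> inv_into U \<phi>)" "\<phi> p \<in> \<phi> ` (U \<inter> W)"
    using assms(1,2) by (auto simp: smooth_fun_def)
  then have "Ck_on (Suc 0) (f \<circ> inv_into U \<phi>) (\<phi> ` (U \<inter> W))"
    by (simp only: smooth_on_def)
  with \<open>\<phi> p \<in> \<phi> ` (U \<inter> W)\<close> show ?thesis
    unfolding Ck_on.simps by blast
qed

lemma chart_vector_lincomb:
  assumes "(U, \<phi>) \<in> atlas M" "p \<in> U"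
  shows "chart_vector M U \<phi> p (a *\<^sub>R x + b *\<^sub>R y) =
    lincomb a (chart_vector M U \<phi> p x) b (chart_vector M U \<phi> p y)"
proof (rule ext)
  fix f
  show "chart_vector M U \<phi> p (a *\<^sub>R x + b *\<^sub>R y) f =
    lincomb a (chart_vector M U \<phi> p x) b (chart_vector M U \<phi> p y) f"
  proof (cases "smooth_near M p f")
    case True
    interpret linear "frechet_derivative (f \<circ> inv_into U \<phi>) (at (\<phi> p))"
      using smooth_near_differentiable[OF assms True] by (rule linear_frechet_derivative)
    show ?thesis using True by (simp add: chart_vector_def lincomb_def add scale)
  qed (simp add: chart_vector_def lincomb_def)
qed

text \<open>The coordinate vector is the velocity of the curve \<open>\<gamma>\<close> that the chart maps to the line through
  \<open>\<phi> p\<close> in direction \<open>x\<close>. In another chart \<open>\<psi>\<close>, this curve is the transition map restricted to a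
  line, hence smooth.\<close>

lemma chart_vector_tangent:
  assumes M: "smooth_manifold M" and U: "(U, \<phi>) \<in> atlas M" and p: "p \<in> U"
  shows "chart_vector M U \<phi> p x \<in> tangent_space M p"
proof -
  define l where "l = (\<lambda>t::real. \<phi> p + t *\<^sub>R x)"
  define \<gamma> where "\<gamma> = inv_into U \<phi> \<circ> l"
  note inj = chart_inj[OF M U]
  have l_cont: "continuous_on A l" for A
    unfolding l_def by (intro continuous_intros)
  have "open (l -` \<phi> ` U)"
    using chart_open[OF M U] l_cont by (rule open_vimage)
  moreover have "0 \<in> l -` \<phi> ` U"
    using p by (simp add: l_def)
  ultimately obtain e where e: "e > 0" "ball 0 e \<subseteq> l -` \<phi> ` U"
    by (meson open_contains_ball)
  define I where "I = {-e<..<e}"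
  have I: "l t \<in> \<phi> ` U" if "t \<in> I" for t
    using e(2) that by (auto simp: I_def subset_iff dist_real_def)
  have \<gamma>0: "\<gamma> 0 = p"
    using inj p by (simp add: \<gamma>_def l_def)
  have cont: "continuous_map (top_of_set I) (mtop M) \<gamma>"
    unfolding \<gamma>_def
    by (rule continuous_map_compose[OF _ chart_inv_continuous[OF M U]])
      (use I l_cont in auto)
  have curve: "smooth_curve M I \<gamma>"
    unfolding smooth_curve_def
  proof (intro conjI cont ballI, goal_cases)
    case 1
    show "open I" by (simp add: I_def)
  next
    case (2 c)
    obtain V \<psi> where c: "c = (V, \<psi>)" by force
    with 2 have V: "(V, \<psi>) \<in> atlas M" by simp
    define T where "T = {t \<in> I. \<gamma> t \<in> V}"
    have "openin (top_of_set I) T"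
      using openin_continuous_map_preimage[OF cont chart_openin[OF M V]] by (simp add: T_def)
    then have openT: "open T"
      by (rule openin_open_trans) (simp add: I_def)
    have l_mem: "l t \<in> \<phi> ` (U \<inter> V)" if "t \<in> T" for t
    proof -
      obtain q where q: "q \<in> U" "l t = \<phi> q"
        using I[of t] \<open>t \<in> T\<close> by (auto simp: T_def)
      then have "q \<in> V"
        using that inj by (simp add: T_def \<gamma>_def)
      with q show ?thesis by auto
    qed
    have transition: "smooth_on (\<phi> ` (U \<inter> V)) (\<psi> \<circ> inv_into U \<phi>)"
      using M U V by (fastforce simp: smooth_manifold_def)
    have "Ck_on k (\<lambda>t. (\<psi> \<circ> inv_into U \<phi>) (l t)) T" for k
      unfolding l_def using openT l_mem[unfolded l_def]
        transition[unfolded smooth_on_def, rule_format]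
      by (rule Ck_on_line)
    then have "smooth_on T (\<lambda>t. (\<psi> \<circ> inv_into U \<phi>) (l t))"
      by (simp add: smooth_on_def)
    then have "smooth_on T (\<psi> \<circ> \<gamma>)"
      by (simp add: \<gamma>_def comp_def)
    then show ?case by (simp add: c T_def)
  qed
  have "velocity M \<gamma> = chart_vector M U \<phi> p x"
  proof (rule ext)
    fix f
    show "velocity M \<gamma> f = chart_vector M U \<phi> p x f"
    proof (cases "smooth_near M p f")
      case True
      define F where "F = f \<circ> inv_into U \<phi>"
      have "(F has_derivative frechet_derivative F (at (\<phi> p))) (at (\<phi> p))"
        using smooth_near_differentiable[OF U p True]
        by (simp add: F_def frechet_derivative_works)
      then have F: "(F has_derivative frechet_derivative F (at (\<phi> p))) (at (l 0))"
        by (simp add: l_def)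
      have "(l has_derivative (\<lambda>s. s *\<^sub>R x)) (at 0)"
        unfolding l_def by (auto intro!: derivative_eq_intros)
      from has_derivative_compose[OF this F]
      have "((f \<circ> \<gamma>) has_derivative (\<lambda>s. frechet_derivative F (at (\<phi> p)) (s *\<^sub>R x))) (at 0)"
        by (simp add: F_def \<gamma>_def comp_def)
      moreover have "(\<lambda>s. frechet_derivative F (at (\<phi> p)) (s *\<^sub>R x)) =
          (*) (frechet_derivative F (at (\<phi> p)) x)"
        using linear_scale[OF has_derivative_linear[OF F]] by (simp add: fun_eq_iff mult.commute)
      ultimately have "((f \<circ> \<gamma>) has_real_derivative frechet_derivative F (at (\<phi> p)) x) (at 0)"
        by (simp add: has_field_derivative_def)
      then show ?thesis
        using True by (simp add: velocity_def chart_vector_def \<gamma>0 F_def DERIV_imp_deriv)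
    qed (simp add: velocity_def chart_vector_def \<gamma>0)
  qed
  then show ?thesis
    using curve e(1) \<gamma>0 by (force simp: tangent_space_def I_def)
qed

text \<open>In a chart \<open>\<psi>\<close>, a coordinate function of \<open>\<phi>\<close> is a component of the transition map.\<close>

lemma smooth_near_coordinate:
  assumes M: "smooth_manifold M" and U: "(U, \<phi>) \<in> atlas M" and p: "p \<in> U"
  shows "smooth_near M p (\<lambda>q. \<phi> q $ i)"
proof -
  have "smooth_on (\<psi> ` (V \<inter> U)) ((\<lambda>q. \<phi> q $ i) \<circ> inv_into V \<psi>)" if V: "(V, \<psi>) \<in> atlas M" for V \<psi>
  proof -
    have "smooth_on (\<psi> ` (V \<inter> U)) (\<phi> \<circ> inv_into V \<psi>)"
      using M U V by (fastforce simp: smooth_manifold_def)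
    with chart_image_open[OF M V chart_openin[OF M U]] show ?thesis
      using Ck_on_bounded_linear[of _ "\<lambda>y. y $ i", OF _ bounded_linear_vec_nth]
      by (fastforce simp: smooth_on_def comp_def)
  qed
  then have "smooth_fun M U (\<lambda>q. \<phi> q $ i)"
    using chart_openin[OF M U] by (auto simp: smooth_fun_def)
  with p show ?thesis by (auto simp: smooth_near_def)
qed

lemma chart_vector_coordinate:
  assumes M: "smooth_manifold M" and U: "(U, \<phi>) \<in> atlas M" and p: "p \<in> U"
  shows "chart_vector M U \<phi> p x (\<lambda>q. \<phi> q $ i) = x $ i"
proof -
  have "((\<lambda>q. \<phi> q $ i) \<circ> inv_into U \<phi> has_derivative (\<lambda>y. y $ i)) (at (\<phi> p))"
  proof (rule has_derivative_transform_within_open)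
    show "((\<lambda>y. y $ i) has_derivative (\<lambda>y. y $ i)) (at (\<phi> p))"
      by (rule bounded_linear_imp_has_derivative[OF bounded_linear_vec_nth])
    show "open (\<phi> ` U)" by (rule chart_open[OF M U])
  qed (use p in \<open>auto simp: f_inv_into_f\<close>)
  then have "frechet_derivative ((\<lambda>q. \<phi> q $ i) \<circ> inv_into U \<phi>) (at (\<phi> p)) = (\<lambda>y. y $ i)"
    using frechet_derivative_at by metis
  then show ?thesis
    using smooth_near_coordinate[OF assms] by (simp add: chart_vector_def)
qed


section \<open>Orthonormal bases of the tangent spaces\<close>

text \<open>Induction on the index set: as long as fewer than \<open>n\<close> vectors are chosen, dimension leaves a
  vector outside their span, and subtracting its \<open>B\<close>-projection and normalizing gives the next one.\<close>

lemma gram_schmidt: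
  fixes B :: "real ^ 'n::finite \<Rightarrow> real ^ 'n \<Rightarrow> real"
  assumes sym: "\<And>x y. B x y = B y x"
    and lin: "\<And>y. linear (\<lambda>x. B x y)"
    and pos: "\<And>x. x \<noteq> 0 \<Longrightarrow> B x x > 0"
  shows "\<exists>e::'n \<Rightarrow> real ^ 'n. \<forall>i j. B (e i) (e j) = (if i = j then 1 else 0)"
proof -
  have "\<exists>e::'n \<Rightarrow> real ^ 'n. \<forall>i\<in>A. \<forall>j\<in>A. B (e i) (e j) = (if i = j then 1 else 0)" for A :: "'n set"
    using finite[of A]
  proof (induction A rule: finite_induct)
    case empty
    then show ?case by simp
  next
    case (insert k A)
    then obtain e where e: "B (e i) (e j) = (if i = j then 1 else 0)" if "i \<in> A" "j \<in> A" for i j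
      by blast
    have "dim (e ` A) \<le> card A"
      using dim_le_card'[of "e ` A"] card_image_le[of A e] by simp
    also have "card A < CARD('n)"
      using insert.hyps by (intro psubset_card_mono) auto
    finally have "dim (span (e ` A)) \<noteq> dim (UNIV :: (real ^ 'n) set)"
      by simp
    then have "span (e ` A) \<noteq> UNIV" by metis
    then obtain v where v: "v \<notin> span (e ` A)" by blast
    define w where "w = v - (\<Sum>i\<in>A. B v (e i) *\<^sub>R e i)"
    have "(\<Sum>i\<in>A. B v (e i) *\<^sub>R e i) \<in> span (e ` A)"
      by (intro span_sum span_scale span_base) auto
    then have "w \<noteq> 0" using v by (auto simp: w_def)
    then have w_pos: "B w w > 0" by (rule pos)
    have w_orth: "B w (e j) = 0" if "j \<in> A" for j
    proof -
      interpret linear "\<lambda>x. B x (e j)" by (rule lin)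
      have "B w (e j) = B v (e j) - (\<Sum>i\<in>A. B v (e i) * B (e i) (e j))"
        by (simp add: w_def diff sum scale)
      also have "(\<Sum>i\<in>A. B v (e i) * B (e i) (e j)) = (\<Sum>i\<in>A. if i = j then B v (e i) else 0)"
        using e that by (intro sum.cong) auto
      finally show ?thesis using that insert.hyps by simp
    qed
    define u where "u = (1 / sqrt (B w w)) *\<^sub>R w"
    have u_scale: "B u y = B w y / sqrt (B w w)" for y
      using linear_scale[OF lin[of y]] by (simp add: u_def)
    have u_unit: "B u u = 1"
      using u_scale[of u] u_scale[of w] sym[of w u] w_pos by (simp add: real_div_sqrt)
    have u_orth: "B u (e j) = 0" "B (e j) u = 0" if "j \<in> A" for j
      using w_orth[OF that] u_scale[of "e j"] sym[of "e j" u] by simp_all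
    have "\<forall>i\<in>insert k A. \<forall>j\<in>insert k A.
        B ((e(k := u)) i) ((e(k := u)) j) = (if i = j then 1 else 0)"
      using insert.hyps e u_unit u_orth by auto
    then show ?case by blast
  qed
  from this[of UNIV] show ?thesis by simp
qed

text \<open>The vectors are coordinate vectors of a chart around \<open>p\<close>, orthonormalized for the pullback
  \<open>B\<close> of the metric to \<open>\<real>\<^sup>n\<close>. Definiteness of \<open>B\<close> is the injectivity of the coordinate vector map.\<close>

lemma orthonormal_basis_exists:
  fixes M :: "('a, 'n::finite) manifold"
  assumes M: "smooth_manifold M" and g: "riemannian_metric M g" and p: "p \<in> points M"
  shows "\<exists>E. orthonormal_basis M g p E"
proof -
  obtain U \<phi> where U: "(U, \<phi>) \<in> atlas M" and pU: "p \<in> U"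
  proof -
    have "p \<in> \<Union> (fst ` atlas M)"
      using M p unfolding smooth_manifold_def by blast
    then show ?thesis using that by force
  qed
  define L where "L = chart_vector M U \<phi> p"
  have L_tan: "L x \<in> tangent_space M p" for x
    unfolding L_def by (rule chart_vector_tangent[OF M U pU])
  have L_comb: "L (a *\<^sub>R x + b *\<^sub>R y) = lincomb a (L x) b (L y)" for a b x y
    unfolding L_def by (rule chart_vector_lincomb[OF U pU])
  have L_nonzero: "L x \<noteq> (\<lambda>_. 0)" if "x \<noteq> 0" for x
  proof
    assume "L x = (\<lambda>_. 0)"
    then have "x $ i = 0" for i
      using chart_vector_coordinate[OF M U pU, of x i] by (simp add: L_def)
    then show False using that by (simp add: vec_eq_iff)
  qed
  define B where "B x y = g p (L x) (L y)" for x y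
  have g_at: "g p u v = g p v u"
      "g p (lincomb a u b v) w = a * g p u w + b * g p v w"
      "u \<noteq> (\<lambda>_. 0) \<Longrightarrow> g p u u > 0"
    if "u \<in> tangent_space M p" "v \<in> tangent_space M p" "w \<in> tangent_space M p" for u v w a b
    using g p that unfolding riemannian_metric_def by blast+
  have B_comb: "B (a *\<^sub>R x + b *\<^sub>R y) z = a * B x z + b * B y z" for a b x y z
    unfolding B_def L_comb by (rule g_at(2)) (rule L_tan)+
  have "\<exists>e::'n \<Rightarrow> real ^ 'n. \<forall>i j. B (e i) (e j) = (if i = j then 1 else 0)"
  proof (rule gram_schmidt)
    show "B x y = B y x" for x y
      unfolding B_def by (rule g_at(1)) (rule L_tan)+
    show "linear (\<lambda>x. B x y)" for y
      using B_comb[of 1 _ 1 _ y] B_comb[of _ _ 0 0 y] by (intro linearI) simp_all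
    show "B x x > 0" if "x \<noteq> 0" for x
      unfolding B_def using L_nonzero[OF that] g_at(3)[OF L_tan L_tan L_tan] by blast
  qed
  then obtain e :: "'n \<Rightarrow> real ^ 'n" where "\<forall>i j. B (e i) (e j) = (if i = j then 1 else 0)" by blast
  then have "orthonormal_basis M g p (\<lambda>i. L (e i))"
    by (simp add: orthonormal_basis_def B_def L_tan)
  then show ?thesis by blast
qed

lemma orthonormal_basis_frame:
  assumes "smooth_manifold M" "riemannian_metric M g" "p \<in> points M"
  shows "orthonormal_basis M g p (frame M g p)"
  unfolding frame_def using orthonormal_basis_exists[OF assms] by (rule someI_ex)


section \<open>The norm identity of a gradient Ricci soliton\<close>

text \<open>Since \<open>T = - S - c g\<close>, the constant \<open>c\<close> enters \<open>\<parallel>T\<parallel>\<^sup>2\<close> only through \<open>2 c tr S + n c\<^sup>2\<close>, and the trace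
  identity gives \<open>c = - (tr S + tr T) / n\<close>.\<close>

lemma opposite_up_to_metric:
  fixes M :: "('a, 'n::finite) manifold"
  assumes E: "orthonormal_basis M g p (frame M g p)"
    and sum0: "\<And>v w. v \<in> tangent_space M p \<Longrightarrow> w \<in> tangent_space M p \<Longrightarrow>
      S p v w + T p v w + c * g p v w = 0"
  shows trace_identity:
      "metric_trace M g S p + metric_trace M g T p + c * real CARD('n) = 0" (is ?tr)
    and norm_sq_identity: "norm_sq M g T p - norm_sq M g S p =
      ((metric_trace M g T p)\<^sup>2 - (metric_trace M g S p)\<^sup>2) / real CARD('n)" (is ?nm)
proof -
  define s where "s i j = S p (frame M g p i) (frame M g p j)" for i j
  define t where "t i j = T p (frame M g p i) (frame M g p j)" for i j
  define n where "n = real CARD('n)"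
  have n: "n > 0" by (simp add: n_def)
  have t: "t i j = - s i j - c * (if i = j then 1 else 0)" for i j
    using sum0[of "frame M g p i" "frame M g p j"] E
    by (auto simp: orthonormal_basis_def s_def t_def split: if_splits)
  have tr: "metric_trace M g T p = - metric_trace M g S p - c * n"
    unfolding metric_trace_def s_def[symmetric] t_def[symmetric]
    by (simp add: t sum_subtractf sum_negf n_def)
  then show ?tr by (simp add: n_def)
  \<comment> \<open>off the diagonal \<open>t i j = - s i j\<close>, so \<open>c\<close> contributes to the \<open>n\<close> diagonal squares only\<close>
  have sq: "(t i j)\<^sup>2 = (s i j)\<^sup>2 + (if i = j then 2 * c * s i i + c\<^sup>2 else 0)" for i j
    by (simp add: t power2_eq_square algebra_simps)
  have "norm_sq M g T p = norm_sq M g S p + 2 * c * metric_trace M g S p + n * c\<^sup>2"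
    unfolding metric_trace_def norm_sq_def s_def[symmetric] t_def[symmetric]
    by (simp add: sq sum.distrib sum_distrib_left n_def)
  then show ?nm
    using n unfolding tr n_def[symmetric] by (simp add: field_simps power2_eq_square)
qed

theorem mainTheorem1:
  fixes M :: "('a, 'n::finite) manifold"
    and g :: "'a tensor02"
    and D :: "'a connection"
    and f :: "'a \<Rightarrow> real"
    and c :: real
  defines "n \<equiv> real CARD('n)"
    and "H \<equiv> hessian M g D f"
    and "Lap \<equiv> laplacian M g D f"
    and "Ric \<equiv> ricci M g D"
    and "R \<equiv> scalar_curvature M g D"
  assumes "smooth_manifold M"
    and "riemannian_metric M g"
    and "levi_civita M g D"
    and "smooth_fun M (points M) f"
    and "gradient_ricci_soliton M g D f c"
  shows "(\<forall>p\<in>points M.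
            norm_sq M g H p - 1 / n * (Lap p)\<^sup>2 \<le> norm_sq M g Ric p \<and>
            norm_sq M g Ric p \<le> norm_sq M g H p + (R p)\<^sup>2 / n) \<and>
         (\<forall>p\<in>points M.
            norm_sq M g H p - 1 / n * (Lap p)\<^sup>2 = norm_sq M g Ric p \<and>
            norm_sq M g Ric p = norm_sq M g H p + (R p)\<^sup>2 / n \<longleftrightarrow>
            (tensor_eq_at M p H Ric \<or> tensor_eq_at M p H (\<lambda>q v w. - Ric q v w)) \<and>
            Lap p = 0 \<and> R p = 0) \<and>
         ((\<forall>p\<in>points M.
            norm_sq M g H p - 1 / n * (Lap p)\<^sup>2 = norm_sq M g Ric p \<and>
            norm_sq M g Ric p = norm_sq M g H p + (R p)\<^sup>2 / n) \<longleftrightarrow>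
            ((\<forall>p\<in>points M. tensor_eq_at M p H Ric) \<or>
             (\<forall>p\<in>points M. tensor_eq_at M p H (\<lambda>q v w. - Ric q v w))) \<and>
            (\<forall>p\<in>points M. Lap p = 0 \<and> R p = 0)) \<and>
         ((\<forall>p\<in>points M.
            norm_sq M g H p - 1 / n * (Lap p)\<^sup>2 = norm_sq M g Ric p \<and>
            norm_sq M g Ric p = norm_sq M g H p + (R p)\<^sup>2 / n) \<longrightarrow>
            harmonic M g D f)"
proof -
  have n: "n > 0" by (simp add: n_def)
  have sol: "H p v w + Ric p v w + c * g p v w = 0"
    if "p \<in> points M" "v \<in> tangent_space M p" "w \<in> tangent_space M p" for p v w
    using assms(10) that by (simp add: gradient_ricci_soliton_def H_def Ric_def)
  have frame_on: "orthonormal_basis M g p (frame M g p)" if "p \<in> points M" for p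
    using assms(6,7) that by (rule orthonormal_basis_frame)
  have tr: "Lap p + R p + c * n = 0" if "p \<in> points M" for p
    using trace_identity[of M g p H Ric c, OF frame_on[OF that] sol[OF that]]
    by (simp add: Lap_def R_def H_def Ric_def n_def laplacian_def scalar_curvature_def)
  have diff: "norm_sq M g Ric p - norm_sq M g H p = ((R p)\<^sup>2 - (Lap p)\<^sup>2) / n"
    if "p \<in> points M" for p
    using norm_sq_identity[of M g p H Ric c, OF frame_on[OF that] sol[OF that]]
    by (simp add: Lap_def R_def H_def Ric_def n_def laplacian_def scalar_curvature_def)
  define eqs where "eqs p \<longleftrightarrow> norm_sq M g H p - 1 / n * (Lap p)\<^sup>2 = norm_sq M g Ric p \<and>
            norm_sq M g Ric p = norm_sq M g H p + (R p)\<^sup>2 / n" for p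
  have ineq: "norm_sq M g H p - 1 / n * (Lap p)\<^sup>2 \<le> norm_sq M g Ric p \<and>
            norm_sq M g Ric p \<le> norm_sq M g H p + (R p)\<^sup>2 / n" if "p \<in> points M" for p
  proof -
    have "norm_sq M g Ric p = norm_sq M g H p + (R p)\<^sup>2 / n - (Lap p)\<^sup>2 / n"
      using diff[OF that] by (simp add: diff_divide_distrib)
    moreover have "0 \<le> (R p)\<^sup>2 / n" "0 \<le> (Lap p)\<^sup>2 / n"
      using n by simp_all
    ultimately show ?thesis by simp
  qed
  have eqs_iff: "eqs p \<longleftrightarrow> Lap p = 0 \<and> R p = 0" if "p \<in> points M" for p
  proof -
    have "norm_sq M g Ric p = norm_sq M g H p + (R p)\<^sup>2 / n - (Lap p)\<^sup>2 / n"
      using diff[OF that] by (simp add: diff_divide_distrib)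
    then have "eqs p \<longleftrightarrow> (R p)\<^sup>2 / n = 0 \<and> (Lap p)\<^sup>2 / n = 0"
      by (auto simp: eqs_def)
    then show ?thesis using n by auto
  qed
  \<comment> \<open>the sign is the same at every point, which gives the global characterization of equality
    as well as the pointwise one\<close>
  have opposite: "tensor_eq_at M p H (\<lambda>q v w. - Ric q v w)"
    if "p \<in> points M" "Lap p = 0" "R p = 0" for p
  proof -
    have "c = 0" using tr[OF that(1)] that n by simp
    then show ?thesis using sol[OF that(1)] by (force simp: tensor_eq_at_def)
  qed
  have "harmonic M g D f" if "\<forall>p\<in>points M. eqs p"
    using that eqs_iff by (simp add: harmonic_def Lap_def)
  then show ?thesis
    unfolding eqs_def[symmetric] using ineq eqs_iff opposite by blast
qed

end
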